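(* Let $F$ be a nonsingular unsatisfiable hitting clause-set which is clause-reducible, and let $F=(F_0,C)\diamond G$ be a nontrivial clause-factorisation. Let $k:=\delta(F)$ (so $k\ge 2$). (1) If $F$ is strictly fs-resolvable, then $n(F)\le \mathrm{N}(k-1)+3$. (2) Otherwise $n(F)\le \mathrm{N}(\delta(F_0))+\mathrm{N}(\delta(G))+|\mathrm{var}(F_0)\cap\mathrm{var}(G)|+1$. (3) Assume that $\mathrm{N}(k')=4k'-5$ for all integers $k'$ with $2\le k'<k$. (a) If $F$ is strictly fs-resolvable, then $n(F)\le 4k-6$. (b) Otherwise $n(F)\le 4k-5-3\cdot|\mathrm{var}(F_0)\cap\mathrm{var}(G)|\le 4k-5$.
   Context: Variables are positive integers, literals are nonzero integers, the complement of $x$ is $\overline{x}=-x$, and $\mathrm{var}(x)=|x|$. A clause is a finite set of literals with no pair $x,\overline{x}$; $\bot$ is the empty clause. A clause-set is a finite set of clauses; $\top$ is the empty clause-set. $\mathrm{var}(F)$ is the set of variables occurring in $F$, $n(F)=|\mathrm{var}(F)|$, $c(F)=|F|$, $\delta(F)=c(F)-n(F)$. $F$ is satisfiable if some clause meets every clause of $F$, otherwise unsatisfiable. $F$ is hitting if any two distinct clauses $C,D\in F$ have some $x\in C$ with $\overline{x}\in D$. $\mathrm{ldeg}_F(x)$ is the number of clauses containing $x$; $v\in\mathrm{var}(F)$ is singular if $\min(\mathrm{ldeg}_F(v),\mathrm{ldeg}_F(\overline v))=1$; $F$ is nonsingular if it has no singular variables. $\mathrm{N}(k)\in\mathbb{N}_0\cup\{+\infty\}$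 is the supremum of $n(F)$ over nonsingular unsatisfiable hitting clause-sets with $\delta(F)=k$. Clause-factors: a clause-set $F'\ne\top$ is a clause-factor if $\{D\setminus\bigcap F':D\in F'\}$ is unsatisfiable; a clause-factor of $F$ is a subset of $F$ which is a clause-factor; it is trivial if $c(F')=1$ or ($F'$ unsatisfiable and $F'=F$); $F$ is clause-reducible if it has a nontrivial clause-factor. Clause-factorisation: for clause-sets $F_0,G$ and $C\in F_0$, $(F_0,C)\diamond G:=(F_0\setminus\{C\})\cup\{C\cup D: D\in G, C\cap\overline{D}=\emptyset\}$. This is a clause-factorisation if $\mathrm{var}(C)\cap\mathrm{var}(G)=\emptyset$, the two sets in the union are disjoint, and $G$ is unsatisfiable; it is nontrivial if $F_0\ne\{\bot\}$ and $G\ne\{\bot\}$. Full-subsumption: an fs-pair is a pair of clauses $\{E\cup\{v\},E\cup\{\overline v\}\}$ with $v,\overline v\notin E$; fs-resolution on $F$ replaces an fs-pair $\{E\cup\{v\},E\cup\{\overline v\}\}\subseteq F$ with $E\notin F$ by $E$; it is strict if the resulting clause-set has the same set of variables as $F$. $F$ is strictly fs-resolvable if a strict fs-resolution is possible on $F$. *)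

theory Defs
  imports Main "HOL-Library.Extended_Nat"
begin

text \<open>Literals are nonzero integers, variables are positive integers, and the complement
  of a literal is its negation.\<close>

type_synonym literal = int
type_synonym clause = "literal set"
type_synonym clause_set = "clause set"

definition is_clause :: "clause \<Rightarrow> bool" where
  "is_clause C \<longleftrightarrow> finite C \<and> 0 \<notin> C \<and> (\<forall>x\<in>C. - x \<notin> C)"

definition is_clause_set :: "clause_set \<Rightarrow> bool" where
  "is_clause_set F \<longleftrightarrow> finite F \<and> (\<forall>C\<in>F. is_clause C)"

definition var_clause :: "clause \<Rightarrow> int set" where
  "var_clause C = abs ` C"

definition var :: "clause_set \<Rightarrow> int set" where
  "var F = (\<Union>C\<in>F. var_clause C)"

definition n_var :: "clause_set \<Rightarrow> nat" where
  "n_var F = card (var F)"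

definition deficiency :: "clause_set \<Rightarrow> int" where
  "deficiency F = int (card F) - int (n_var F)"

text \<open>The clause \<open>\<phi>\<close> is the partial assignment that makes exactly its own literals true.\<close>

definition satisfiable :: "clause_set \<Rightarrow> bool" where
  "satisfiable F \<longleftrightarrow> (\<exists>\<phi>. is_clause \<phi> \<and> (\<forall>C\<in>F. \<phi> \<inter> C \<noteq> {}))"

definition hitting :: "clause_set \<Rightarrow> bool" where
  "hitting F \<longleftrightarrow> (\<forall>C\<in>F. \<forall>D\<in>F. C \<noteq> D \<longrightarrow> (\<exists>x\<in>C. - x \<in> D))"

definition ldeg :: "clause_set \<Rightarrow> literal \<Rightarrow> nat" where
  "ldeg F x = card {C \<in> F. x \<in> C}"

definition singular_var :: "clause_set \<Rightarrow> int \<Rightarrow> bool" where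
  "singular_var F v \<longleftrightarrow> v \<in> var F \<and> min (ldeg F v) (ldeg F (- v)) = 1"

definition nonsingular :: "clause_set \<Rightarrow> bool" where
  "nonsingular F \<longleftrightarrow> (\<forall>v. \<not> singular_var F v)"

definition nonsingular_uhit :: "clause_set \<Rightarrow> bool" where
  "nonsingular_uhit F \<longleftrightarrow>
     is_clause_set F \<and> hitting F \<and> \<not> satisfiable F \<and> nonsingular F"

text \<open>The function N. The supremum is taken in \<^typ>\<open>enat\<close>, where the supremum of the
  empty set is 0.\<close>

definition N_sup :: "int \<Rightarrow> enat" where
  "N_sup k = Sup {enat (n_var F) | F. nonsingular_uhit F \<and> deficiency F = k}"

definition clause_factor :: "clause_set \<Rightarrow> bool" where
  "clause_factor F' \<longleftrightarrow>
     is_clause_set F' \<and> F' \<noteq> {} \<and> \<not> satisfiable {D - \<Inter> F' | D. D \<in> F'}"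

definition clause_factor_of :: "clause_set \<Rightarrow> clause_set \<Rightarrow> bool" where
  "clause_factor_of F' F \<longleftrightarrow> F' \<subseteq> F \<and> clause_factor F'"

definition trivial_clause_factor :: "clause_set \<Rightarrow> clause_set \<Rightarrow> bool" where
  "trivial_clause_factor F' F \<longleftrightarrow> card F' = 1 \<or> (\<not> satisfiable F' \<and> F' = F)"

definition clause_reducible :: "clause_set \<Rightarrow> bool" where
  "clause_reducible F \<longleftrightarrow>
     (\<exists>F'. clause_factor_of F' F \<and> \<not> trivial_clause_factor F' F)"

definition clause_products :: "clause \<Rightarrow> clause_set \<Rightarrow> clause_set" where
  "clause_products C G = {C \<union> D | D. D \<in> G \<and> C \<inter> uminus ` D = {}}"

definition diamond :: "clause_set \<Rightarrow> clause \<Rightarrow> clause_set \<Rightarrow> clause_set" where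
  "diamond F0 C G = (F0 - {C}) \<union> clause_products C G"

definition clause_factorisation :: "clause_set \<Rightarrow> clause \<Rightarrow> clause_set \<Rightarrow> bool" where
  "clause_factorisation F0 C G \<longleftrightarrow>
     is_clause_set F0 \<and> is_clause_set G \<and> C \<in> F0 \<and>
     var_clause C \<inter> var G = {} \<and>
     (F0 - {C}) \<inter> clause_products C G = {} \<and>
     \<not> satisfiable G"

definition nontrivial_clause_factorisation :: "clause_set \<Rightarrow> clause \<Rightarrow> clause_set \<Rightarrow> bool" where
  "nontrivial_clause_factorisation F0 C G \<longleftrightarrow>
     clause_factorisation F0 C G \<and> F0 \<noteq> {{}} \<and> G \<noteq> {{}}"

definition fs_resolution :: "clause_set \<Rightarrow> clause_set \<Rightarrow> bool" where
  "fs_resolution F F' \<longleftrightarrow>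
     (\<exists>E v. is_clause E \<and> v \<noteq> 0 \<and> v \<notin> E \<and> - v \<notin> E \<and>
        {insert v E, insert (- v) E} \<subseteq> F \<and> E \<notin> F \<and>
        F' = insert E (F - {insert v E, insert (- v) E}))"

definition strictly_fs_resolvable :: "clause_set \<Rightarrow> bool" where
  "strictly_fs_resolvable F \<longleftrightarrow> (\<exists>F'. fs_resolution F F' \<and> var F' = var F)"

end

theory Submission imports Defs begin

text \<open>Eliminating a singular variable of an unsatisfiable hitting clause-set preserves the
  deficiency. If the variable has degrees \<open>(1,m)\<close> with \<open>m \<ge> 2\<close>, this creates no new singular
  variables, so without variables of degrees \<open>(1,1)\<close> the bound \<open>N\<close> is exceeded by at most the
  number of singular variables. A strict full-subsumption resolution lowers the deficiency by
  one, and at most two \<open>(1,1)\<close>-eliminations and three eliminations in total lead from its result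
  to a nonsingular clause-set. If no strict resolution is possible, then \<open>F0\<close> and \<open>G\<close> have no
  variables of degrees \<open>(1,1)\<close>, the singular variables of \<open>G\<close> are common to \<open>F0\<close> and \<open>G\<close>, and so are
  those of \<open>F0\<close> with at most one exception, whose singular literal lies in \<open>C\<close>.\<close>

text \<open>This is \<open>nonsingular_uhit\<close> without nonsingularity. Eliminations,
  resolutions and passing to the factors stay inside this class, although they may produce singular
  variables.\<close>

definition uhit :: "clause_set \<Rightarrow> bool" where
  "uhit F \<longleftrightarrow> is_clause_set F \<and> hitting F \<and> \<not> satisfiable F"

text \<open>If \<open>x\<close> occurs in exactly one clause of an unsatisfiable hitting clause-set, this is also the
  Davis-Putnam elimination of the variable of \<open>x\<close>.\<close>

definition set_true :: "clause_set \<Rightarrow> literal \<Rightarrow> clause_set" where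
  "set_true F x = (\<lambda>D. D - {- x}) ` {D \<in> F. x \<notin> D}"

text \<open>In an unsatisfiable hitting clause-set both literals of each variable occur, so the
  disjunction says that the smaller of the two degrees is 1.\<close>

definition sing_vars :: "clause_set \<Rightarrow> int set" where
  "sing_vars F = {v \<in> var F. ldeg F v = 1 \<or> ldeg F (- v) = 1}"

definition no_one_singular :: "clause_set \<Rightarrow> bool" where
  "no_one_singular F \<longleftrightarrow> (\<forall>x. \<not> (ldeg F x = 1 \<and> ldeg F (- x) = 1))"

section \<open>Variables and clauses of unsatisfiable hitting clause-sets\<close>

lemma var_iff: "w \<in> var F \<longleftrightarrow> (\<exists>C\<in>F. \<exists>x\<in>C. w = \<bar>x\<bar>)"
  by (auto simp: var_def var_clause_def)

lemma abs_in_var_iff: "\<bar>x\<bar> \<in> var F \<longleftrightarrow> (\<exists>C\<in>F. x \<in> C \<or> - x \<in> C)"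
proof
  assume "\<bar>x\<bar> \<in> var F"
  then obtain C y where "C \<in> F" "y \<in> C" "\<bar>x\<bar> = \<bar>y\<bar>"
    by (auto simp: var_iff)
  then show "\<exists>C\<in>F. x \<in> C \<or> - x \<in> C"
    by (metis abs_eq_iff minus_minus)
next
  assume "\<exists>C\<in>F. x \<in> C \<or> - x \<in> C"
  then show "\<bar>x\<bar> \<in> var F"
    by (metis abs_minus_cancel var_iff)
qed

lemma uhitD:
  assumes "uhit F"
  shows "finite F" "\<And>C. C \<in> F \<Longrightarrow> is_clause C" "\<not> satisfiable F"
    "\<And>C D. \<lbrakk>C \<in> F; D \<in> F; C \<noteq> D\<rbrakk> \<Longrightarrow> \<exists>x\<in>C. - x \<in> D"
  using assms by (auto simp: uhit_def is_clause_set_def hitting_def)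

lemma is_clause_lit:
  assumes "is_clause C" "x \<in> C"
  shows "x \<noteq> 0" "- x \<notin> C"
  using assms by (auto simp: is_clause_def)

lemma is_clause_subset: "is_clause C \<Longrightarrow> D \<subseteq> C \<Longrightarrow> is_clause D"
  by (auto simp: is_clause_def intro: finite_subset)

lemma finite_var: "is_clause_set F \<Longrightarrow> finite (var F)"
  by (auto simp: is_clause_set_def is_clause_def var_def var_clause_def)

lemma uhit_finite_var: "uhit F \<Longrightarrow> finite (var F)"
  by (simp add: finite_var uhit_def)

lemma uhit_var_pos:
  assumes "uhit F" "w \<in> var F"
  shows "w > 0"
  using assms uhitD(2)[OF assms(1)] is_clause_lit(1) by (fastforce simp: var_iff)

lemma uhit_nonempty: "uhit F \<Longrightarrow> F \<noteq> {}"
  by (auto dest!: uhitD(3) simp: satisfiable_def is_clause_def)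

text \<open>A clash between distinct clauses \<open>C\<close> and \<open>D\<close> with
  \<open>C\<close> inside \<open>D\<close> would put a complementary pair into
  \<open>D\<close>.\<close>

lemma uhit_subsumption_free:
  assumes "uhit F" "C \<in> F" "D \<in> F" "C \<subseteq> D"
  shows "C = D"
proof (rule ccontr)
  assume "C \<noteq> D"
  then obtain x where "x \<in> C" "- x \<in> D" using uhitD(4)[OF assms(1-3)] by auto
  then show False using is_clause_lit(2)[OF uhitD(2)[OF assms(1,3)]] assms(4) by blast
qed

lemma uhit_var_nonempty:
  assumes "uhit F" "F \<noteq> {{}}"
  shows "var F \<noteq> {}"
proof -
  have "{} \<notin> F"
  proof
    assume "{} \<in> F"
    then have "D = {}" if "D \<in> F" for D
      using uhit_subsumption_free[OF assms(1) _ that, of "{}"] by simp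
    then show False using assms(2) \<open>{} \<in> F\<close> by blast
  qed
  moreover obtain C where C: "C \<in> F" using uhit_nonempty[OF assms(1)] by auto
  ultimately have "C \<noteq> {}" by metis
  then show ?thesis using C by (auto simp: var_def var_clause_def)
qed

lemma uhit_no_vars: "uhit F \<Longrightarrow> var F = {} \<Longrightarrow> F = {{}}"
  using uhit_var_nonempty by blast

section \<open>Literal degrees and singular literals\<close>

lemma ldeg_pos_iff: "finite F \<Longrightarrow> ldeg F x > 0 \<longleftrightarrow> (\<exists>C\<in>F. x \<in> C)"
  by (auto simp: ldeg_def card_gt_0_iff)

lemma ldeg_eq_1E:
  assumes "ldeg F x = 1"
  obtains C where "C \<in> F" "x \<in> C" "\<And>D. D \<in> F \<Longrightarrow> x \<in> D \<Longrightarrow> D = C"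
proof -
  obtain C where "{D \<in> F. x \<in> D} = {C}"
    using assms unfolding ldeg_def by (rule card_1_singletonE)
  then show ?thesis by (intro that) auto
qed

lemma ldeg_eq_1_unique: "\<lbrakk>ldeg F x = 1; C \<in> F; D \<in> F; x \<in> C; x \<in> D\<rbrakk> \<Longrightarrow> C = D"
  by (metis ldeg_eq_1E)

lemma ldeg_1_var: "ldeg F x = 1 \<Longrightarrow> \<bar>x\<bar> \<in> var F"
  unfolding abs_in_var_iff by (metis ldeg_eq_1E)

text \<open>If \<open>x\<close> occurred nowhere, take a clause \<open>C\<close> containing
  \<open>-x\<close>. The assignment that makes \<open>-x\<close> true and all other literals of
  \<open>C\<close> false satisfies \<open>C\<close>, and also every other clause, since that clause
  clashes with \<open>C\<close> in a literal other than \<open>-x\<close>.\<close>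

lemma uhit_both_polarities:
  assumes F: "uhit F" and x: "\<bar>x\<bar> \<in> var F"
  shows "\<exists>C\<in>F. x \<in> C"
proof (rule ccontr)
  assume no: "\<not> (\<exists>C\<in>F. x \<in> C)"
  then obtain C where C: "C \<in> F" "- x \<in> C" using x unfolding abs_in_var_iff by blast
  define P where "P = insert (- x) (uminus ` (C - {- x}))"
  have cl: "is_clause C" using uhitD(2) F C by blast
  have "is_clause P"
    using cl C unfolding is_clause_def P_def by auto
  moreover have "P \<inter> D \<noteq> {}" if D: "D \<in> F" for D
  proof (cases "D = C")
    case True
    then show ?thesis using C by (auto simp: P_def)
  next
    case False
    then obtain y where y: "y \<in> C" "- y \<in> D" using uhitD(4)[OF F C(1) D] by auto
    then have "y \<noteq> - x" using no D by auto
    then show ?thesis using y by (auto simp: P_def)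
  qed
  ultimately show False using uhitD(3)[OF F] by (auto simp: satisfiable_def)
qed

lemma uhit_ldeg_pos: "uhit F \<Longrightarrow> \<bar>x\<bar> \<in> var F \<Longrightarrow> ldeg F x > 0"
  by (simp add: ldeg_pos_iff uhitD(1) uhit_both_polarities)

text \<open>Otherwise the assignment falsifying \<open>D\<close> except at \<open>-x\<close>, extended by a literal of
  \<open>C\<close> missing in \<open>D\<close>, satisfies \<open>F\<close>.\<close>

lemma singular_clause_subset:
  assumes F: "uhit F" and x: "ldeg F x = 1" and C: "C \<in> F" "x \<in> C" and D: "D \<in> F" "- x \<in> D"
  shows "C - {x} \<subseteq> D"
proof
  fix y assume y: "y \<in> C - {x}"
  show "y \<in> D"
  proof (rule ccontr)
    assume yD: "y \<notin> D"
    define P where "P = insert y (insert (- x) (uminus ` (D - {- x})))"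
    have cl: "is_clause C" "is_clause D" using uhitD(2) F C D by blast+
    have "x \<noteq> 0" "y \<noteq> 0" "x \<notin> D"
      using is_clause_lit[OF cl(1)] is_clause_lit[OF cl(2) D(2)] C y by auto
    then have "is_clause P"
      using cl(2) y yD C(2) unfolding is_clause_def P_def by auto
    moreover have "P \<inter> E \<noteq> {}" if E: "E \<in> F" for E
    proof (cases "E = C \<or> E = D")
      case True
      then show ?thesis using y D by (auto simp: P_def)
    next
      case False
      then obtain z where z: "z \<in> D" "- z \<in> E" using uhitD(4)[OF F D(1) E] by auto
      have "x \<notin> E" using ldeg_eq_1_unique[OF x C(1) E C(2)] False by auto
      then have "z \<noteq> - x" using z by auto
      then show ?thesis using z by (auto simp: P_def)
    qed
    ultimately show False using uhitD(3)[OF F] by (auto simp: satisfiable_def)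
  qed
qed

text \<open>A clause \<open>D\<close> containing \<open>-x\<close> contains all of \<open>C\<close>
  except \<open>x\<close>, hence also \<open>y\<close>. This is a second occurrence of
  \<open>y\<close>.\<close>

lemma singular_literal_unique:
  assumes F: "uhit F" and C: "C \<in> F" "x \<in> C" "y \<in> C" and "ldeg F x = 1" "ldeg F y = 1"
  shows "x = y"
proof (rule ccontr)
  assume ne: "x \<noteq> y"
  have "\<bar>- x\<bar> \<in> var F" using C abs_in_var_iff by auto
  then obtain D where D: "D \<in> F" "- x \<in> D" using uhit_both_polarities[OF F] by metis
  then have "y \<in> D" using singular_clause_subset[OF F _ C(1,2)] assms ne by blast
  then have "C = D" using ldeg_eq_1_unique assms D by blast
  then show False using D C is_clause_lit(2)[OF uhitD(2)[OF F]] by blast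
qed

lemma card_singular_literals:
  assumes "uhit F" "C \<in> F"
  shows "card (abs ` {x \<in> C. ldeg F x = 1}) \<le> 1" "finite (abs ` {x \<in> C. ldeg F x = 1})"
proof -
  have fin: "finite {x \<in> C. ldeg F x = 1}" using assms uhitD(2) is_clause_def by auto
  then show "finite (abs ` {x \<in> C. ldeg F x = 1})" by simp
  have "card {x \<in> C. ldeg F x = 1} \<le> 1"
    using singular_literal_unique[OF assms] fin by (simp add: card_le_Suc0_iff_eq)
  then show "card (abs ` {x \<in> C. ldeg F x = 1}) \<le> 1"
    using card_image_le[OF fin, of abs] by linarith
qed

text \<open>By \<open>singular_clause_subset\<close>, applied to \<open>x\<close> and to
  \<open>-x\<close>, the two clauses agree except in \<open>x\<close>. So a variable of degrees
  (1,1) always comes from an fs-pair.\<close>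

lemma one_singular_pair:
  assumes F: "uhit F" and "ldeg F x = 1" "ldeg F (- x) = 1"
  obtains A where "insert x A \<in> F" "insert (- x) A \<in> F" "x \<notin> A" "- x \<notin> A" "is_clause A" "x \<noteq> 0"
proof -
  obtain P Q where P: "P \<in> F" "x \<in> P" and Q: "Q \<in> F" "- x \<in> Q"
    using ldeg_eq_1E[OF assms(2)] ldeg_eq_1E[OF assms(3)] by metis
  have cl: "is_clause P" "is_clause Q" using uhitD(2) F P Q by blast+
  have "P - {x} \<subseteq> Q" using singular_clause_subset[OF F assms(2) P Q] .
  moreover have "Q - {- x} \<subseteq> P" using singular_clause_subset[OF F assms(3) Q] P by simp
  moreover have "- x \<notin> P" "x \<notin> Q" "x \<noteq> 0"
    using is_clause_lit[OF cl(1) P(2)] is_clause_lit[OF cl(2) Q(2)] by auto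
  ultimately have "insert x (P - {x}) = P" "insert (- x) (P - {x}) = Q" using P Q by auto
  then show ?thesis using that[of "P - {x}"] P Q \<open>- x \<notin> P\<close> \<open>x \<noteq> 0\<close> is_clause_subset[OF cl(1)] by auto
qed

section \<open>Setting a literal to true\<close>

lemma inj_on_set_true:
  assumes F: "uhit F"
  shows "inj_on (\<lambda>D. D - {- x}) {D \<in> F. x \<notin> D}"
proof (rule inj_onI, rule ccontr)
  fix C D assume CD: "C \<in> {D \<in> F. x \<notin> D}" "D \<in> {D \<in> F. x \<notin> D}"
    and eq: "C - {- x} = D - {- x}" and "C \<noteq> D"
  then obtain y where y: "y \<in> C" "- y \<in> D" using uhitD(4)[OF F] by blast
  \<comment> \<open>As \<open>x\<close> is missing in both clauses, the clash survives the deletion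
    of \<open>-x\<close>, and the equality of the results moves it into \<open>C\<close>
    alone.\<close>
  have "y \<noteq> x" using CD(1) y(1) by blast
  then have "- y \<in> D - {- x}" using y(2) by simp
  then have "- y \<in> C" unfolding eq[symmetric] by simp
  then show False using y(1) CD(1) is_clause_lit(2)[OF uhitD(2)[OF F]] by blast
qed

text \<open>The remaining clauses avoid \<open>x\<close>, so none of their clashes is on the
  variable of \<open>x\<close>. A satisfying assignment of the result, changed to make
  \<open>x\<close> true, would satisfy \<open>F\<close>.\<close>

lemma uhit_set_true:
  assumes F: "uhit F" and "x \<noteq> 0"
  shows "uhit (set_true F x)"
  unfolding uhit_def
proof (intro conjI notI)
  show "is_clause_set (set_true F x)"
    using uhitD(1,2)[OF F] is_clause_subset[OF _ Diff_subset]
    by (auto simp: is_clause_set_def set_true_def)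
  show "hitting (set_true F x)"
    unfolding hitting_def
  proof (intro ballI impI)
    fix C' D' assume "C' \<in> set_true F x" "D' \<in> set_true F x" and ne: "C' \<noteq> D'"
    then obtain C D where C: "C \<in> F" "x \<notin> C" "C' = C - {- x}" and D: "D \<in> F" "x \<notin> D" "D' = D - {- x}"
      by (auto simp: set_true_def)
    then obtain y where y: "y \<in> C" "- y \<in> D" using uhitD(4)[OF F] ne by blast
    then have "y \<noteq> - x" "- y \<noteq> - x" using C D by auto
    then show "\<exists>x\<in>C'. - x \<in> D'" using y C D by blast
  qed
  assume "satisfiable (set_true F x)"
  then obtain P where P: "is_clause P" "\<And>D. D \<in> set_true F x \<Longrightarrow> P \<inter> D \<noteq> {}"
    by (auto simp: satisfiable_def)
  have "is_clause (insert x (P - {- x}))"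
    using P(1) assms(2) by (auto simp: is_clause_def)
  moreover have "insert x (P - {- x}) \<inter> D \<noteq> {}" if "D \<in> F" for D
  proof (cases "x \<in> D")
    case False
    then have "D - {- x} \<in> set_true F x" using that by (auto simp: set_true_def)
    then show ?thesis using P(2) by blast
  qed auto
  ultimately show False using uhitD(3)[OF F] unfolding satisfiable_def by blast
qed

lemma card_set_true:
  assumes F: "uhit F"
  shows "card (set_true F x) + ldeg F x = card F"
proof -
  have "card (set_true F x) = card {D \<in> F. x \<notin> D}"
    unfolding set_true_def by (rule card_image[OF inj_on_set_true[OF F]])
  moreover have "card {D \<in> F. x \<notin> D} + card {D \<in> F. x \<in> D} = card ({D \<in> F. x \<notin> D} \<union> {D \<in> F. x \<in> D})"
    using uhitD(1)[OF F] by (subst card_Un_disjoint) auto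
  moreover have "{D \<in> F. x \<notin> D} \<union> {D \<in> F. x \<in> D} = F" by auto
  ultimately show ?thesis by (simp add: ldeg_def)
qed

lemma ldeg_set_true:
  assumes F: "uhit F" and "y \<noteq> - x"
  shows "ldeg (set_true F x) y + card {D \<in> F. x \<in> D \<and> y \<in> D} = ldeg F y"
proof -
  have "{D \<in> set_true F x. y \<in> D} = (\<lambda>D. D - {- x}) ` {D \<in> F. x \<notin> D \<and> y \<in> D}"
    using assms(2) by (auto simp: set_true_def)
  moreover have "inj_on (\<lambda>D. D - {- x}) {D \<in> F. x \<notin> D \<and> y \<in> D}"
    by (rule inj_on_subset[OF inj_on_set_true[OF F]]) auto
  ultimately have "ldeg (set_true F x) y = card {D \<in> F. x \<notin> D \<and> y \<in> D}"
    by (simp add: ldeg_def card_image)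
  moreover have "card {D \<in> F. x \<notin> D \<and> y \<in> D} + card {D \<in> F. x \<in> D \<and> y \<in> D}
      = card ({D \<in> F. x \<notin> D \<and> y \<in> D} \<union> {D \<in> F. x \<in> D \<and> y \<in> D})"
    using uhitD(1)[OF F] by (subst card_Un_disjoint) auto
  moreover have "{D \<in> F. x \<notin> D \<and> y \<in> D} \<union> {D \<in> F. x \<in> D \<and> y \<in> D} = {D \<in> F. y \<in> D}" by auto
  ultimately show ?thesis by (simp add: ldeg_def)
qed

lemma var_set_true_subset:
  assumes "uhit F"
  shows "var (set_true F x) \<subseteq> var F - {\<bar>x\<bar>}"
proof
  fix w assume "w \<in> var (set_true F x)"
  then obtain D y where D: "D \<in> F" "x \<notin> D" "y \<in> D" "y \<noteq> - x" "w = \<bar>y\<bar>"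
    by (auto simp: var_iff set_true_def)
  then have "\<bar>y\<bar> \<noteq> \<bar>x\<bar>" by (metis abs_eq_iff)
  then show "w \<in> var F - {\<bar>x\<bar>}" using D by (auto simp: var_iff)
qed

text \<open>A variable \<open>w\<close> lost by setting \<open>x\<close> to true occurs only in clauses containing \<open>x\<close>; as
  both its literals occur, each of them has smaller degree than \<open>x\<close>.\<close>

lemma var_set_true:
  assumes F: "uhit F" and min: "\<And>y. \<bar>y\<bar> \<in> var F \<Longrightarrow> ldeg F x \<le> ldeg F y"
  shows "var (set_true F x) = var F - {\<bar>x\<bar>}"
proof (rule antisym[OF var_set_true_subset[OF F]], rule subsetI, rule ccontr)
  fix w assume w: "w \<in> var F - {\<bar>x\<bar>}" and lost: "w \<notin> var (set_true F x)"
  have wpos: "w > 0" using uhit_var_pos[OF F] w by auto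
  have sub: "x \<in> D" if D: "D \<in> F" "w \<in> D \<or> - w \<in> D" for D
  proof (rule ccontr)
    assume "x \<notin> D"
    then have "D - {- x} \<in> set_true F x" using D by (auto simp: set_true_def)
    moreover have "w \<in> D - {- x} \<or> - w \<in> D - {- x}" using D w wpos by auto
    ultimately have "\<bar>w\<bar> \<in> var (set_true F x)"
      unfolding abs_in_var_iff by (rule bexI[rotated])
    then show False using lost wpos by simp
  qed
  have wv: "\<bar>w\<bar> \<in> var F" "\<bar>- w\<bar> \<in> var F" using w wpos by auto
  obtain D where D: "D \<in> F" "- w \<in> D" using uhit_both_polarities[OF F wv(2)] by auto
  have "w \<notin> D" using is_clause_lit(2)[OF uhitD(2)[OF F D(1)] D(2)] by simp
  then have "{D \<in> F. w \<in> D} \<subset> {D \<in> F. x \<in> D}"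
    using sub D by blast
  then have "ldeg F w < ldeg F x"
    unfolding ldeg_def using uhitD(1)[OF F] by (intro psubset_card_mono) auto
  then show False using min[OF wv(1)] by simp
qed

lemma n_var_set_true:
  assumes F: "uhit F" and x: "\<bar>x\<bar> \<in> var F" and min: "\<And>y. \<bar>y\<bar> \<in> var F \<Longrightarrow> ldeg F x \<le> ldeg F y"
  shows "n_var F = n_var (set_true F x) + 1"
    "deficiency F = deficiency (set_true F x) + int (ldeg F x) - 1"
proof -
  show n: "n_var F = n_var (set_true F x) + 1"
    using card_Suc_Diff1[OF uhit_finite_var[OF F] x] var_set_true[OF F min]
    by (simp add: n_var_def)
  show "deficiency F = deficiency (set_true F x) + int (ldeg F x) - 1"
    using n card_set_true[OF F, of x] by (simp add: deficiency_def)
qed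

text \<open>Setting a literal of minimal degree to true loses exactly one variable and lowers the
  deficiency by that degree minus one, so never raises it. The descent ends at \<open>{{}}\<close>,
  of deficiency 1.\<close>

lemma uhit_deficiency_ge_1: "uhit F \<Longrightarrow> deficiency F \<ge> 1"
proof (induction "n_var F" arbitrary: F rule: less_induct)
  case less
  show ?case
  proof (cases "var F = {}")
    case True
    then have "F = {{}}" using uhit_no_vars less by simp
    then show ?thesis using True by (simp add: deficiency_def n_var_def)
  next
    case False
    then obtain w where w: "w \<in> var F" by auto
    then have "\<bar>w\<bar> \<in> var F" using uhit_var_pos[OF less.prems] by force
    then obtain x where x: "\<bar>x\<bar> \<in> var F" "\<And>y. \<bar>y\<bar> \<in> var F \<Longrightarrow> ldeg F x \<le> ldeg F y"
      using ex_has_least_nat[of "\<lambda>x. \<bar>x\<bar> \<in> var F" w "ldeg F"] by blast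
    have "x \<noteq> 0" using uhit_var_pos[OF less.prems x(1)] by auto
    then have "deficiency (set_true F x) \<ge> 1"
      using less.hyps n_var_set_true(1)[OF less.prems x] uhit_set_true[OF less.prems] by simp
    then show ?thesis
      using n_var_set_true(2)[OF less.prems x] uhit_ldeg_pos[OF less.prems x(1)] by linarith
  qed
qed

text \<open>After setting a literal of minimal degree \<open>m\<close> to true the deficiency is
  still at least 1, and \<open>m - 1\<close> was subtracted from it.\<close>

lemma uhit_min_degree:
  assumes F: "uhit F" and "var F \<noteq> {}"
  obtains x where "\<bar>x\<bar> \<in> var F" "int (ldeg F x) \<le> deficiency F"
proof -
  obtain w where w: "w \<in> var F" using assms by auto
  then have "\<bar>w\<bar> \<in> var F" using uhit_var_pos[OF F] by force
  then obtain x where x: "\<bar>x\<bar> \<in> var F" "\<And>y. \<bar>y\<bar> \<in> var F \<Longrightarrow> ldeg F x \<le> ldeg F y"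
    using ex_has_least_nat[of "\<lambda>x. \<bar>x\<bar> \<in> var F" w "ldeg F"] by blast
  have "x \<noteq> 0" using uhit_var_pos[OF F x(1)] by auto
  then have "deficiency (set_true F x) \<ge> 1"
    using uhit_deficiency_ge_1 uhit_set_true[OF F] by simp
  then show ?thesis using n_var_set_true(2)[OF F x] x that by force
qed

section \<open>Nonsingularity and elimination of singular variables\<close>

lemma nonsingular_iff:
  assumes F: "uhit F"
  shows "nonsingular F \<longleftrightarrow> (\<forall>x. ldeg F x \<noteq> 1)"
proof
  assume ns: "nonsingular F"
  show "\<forall>x. ldeg F x \<noteq> 1"
  proof (intro allI notI)
    fix x assume x: "ldeg F x = 1"
    then have v: "\<bar>x\<bar> \<in> var F" by (rule ldeg_1_var)
    then have "ldeg F x > 0" "ldeg F (- x) > 0" using uhit_ldeg_pos[OF F] by auto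
    then have "min (ldeg F \<bar>x\<bar>) (ldeg F (- \<bar>x\<bar>)) = 1" using x by (auto simp: abs_if)
    then show False using ns v by (auto simp: nonsingular_def singular_var_def)
  qed
next
  assume "\<forall>x. ldeg F x \<noteq> 1"
  then show "nonsingular F" unfolding nonsingular_def singular_var_def by (metis min_def)
qed

lemma nonsingular_uhit_iff: "nonsingular_uhit F \<longleftrightarrow> uhit F \<and> (\<forall>x. ldeg F x \<noteq> 1)"
  using nonsingular_iff by (auto simp: nonsingular_uhit_def uhit_def)

lemma nonsingular_ldeg_ge_2:
  assumes "nonsingular_uhit F" "\<bar>x\<bar> \<in> var F"
  shows "ldeg F x \<ge> 2"
proof -
  have "ldeg F x > 0" "ldeg F x \<noteq> 1"
    using assms uhit_ldeg_pos by (auto simp: nonsingular_uhit_iff)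
  then show ?thesis by linarith
qed

lemma nonsingular_deficiency_ge_2:
  assumes "nonsingular_uhit F" "var F \<noteq> {}"
  shows "deficiency F \<ge> 2"
proof -
  have "uhit F" using assms(1) by (simp add: nonsingular_uhit_iff)
  then obtain x where "\<bar>x\<bar> \<in> var F" "int (ldeg F x) \<le> deficiency F"
    using uhit_min_degree assms by blast
  then show ?thesis using nonsingular_ldeg_ge_2[OF assms(1)] by force
qed

lemma ldeg_set_true_singular:
  assumes F: "uhit F" and x: "ldeg F x = 1" and C: "C \<in> F" "x \<in> C" and y: "\<bar>y\<bar> \<noteq> \<bar>x\<bar>"
  shows "ldeg F y = ldeg (set_true F x) y + (if y \<in> C then 1 else 0)"
proof -
  have "x \<in> D \<longleftrightarrow> D = C" if "D \<in> F" for D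
    using ldeg_eq_1_unique[OF x that C(1) _ C(2)] C(2) by blast
  then have "{D \<in> F. x \<in> D \<and> y \<in> D} = (if y \<in> C then {C} else {})"
    using C(1) by auto
  then have "card {D \<in> F. x \<in> D \<and> y \<in> D} = (if y \<in> C then 1 else 0)" by simp
  moreover have "y \<noteq> - x" using y by auto
  ultimately show ?thesis using ldeg_set_true[OF F, of y x] by simp
qed

text \<open>All literals over occurring variables have positive degree, so degree 1 is minimal and
  \<open>n_var_set_true\<close> applies with a loss of \<open>1 - 1\<close> in the
  deficiency.\<close>

lemma singular_reduction:
  assumes F: "uhit F" and x: "ldeg F x = 1"
  shows "uhit (set_true F x)" "n_var F = n_var (set_true F x) + 1"
    "deficiency (set_true F x) = deficiency F" "card F = card (set_true F x) + 1"
proof -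
  have v: "\<bar>x\<bar> \<in> var F" using ldeg_1_var[OF x] .
  have min: "ldeg F x \<le> ldeg F y" if "\<bar>y\<bar> \<in> var F" for y
    using uhit_ldeg_pos[OF F that] x by simp
  have "x \<noteq> 0" using uhit_var_pos[OF F v] by auto
  then show "uhit (set_true F x)" using uhit_set_true[OF F] by simp
  show "n_var F = n_var (set_true F x) + 1" "deficiency (set_true F x) = deficiency F"
    using n_var_set_true[OF F v min] x by auto
  show "card F = card (set_true F x) + 1" using card_set_true[OF F, of x] x by simp
qed

lemma ldeg_1_set_true_var:
  assumes "uhit F" "ldeg (set_true F x) y = 1"
  shows "\<bar>y\<bar> \<noteq> \<bar>x\<bar>"
  using ldeg_1_var[OF assms(2)] var_set_true_subset[OF assms(1)] by blast

text \<open>Every literal of \<open>C\<close> other than \<open>x\<close> also lies in the at least two clauses containing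
  \<open>-x\<close>, so losing \<open>C\<close> does not make it singular.\<close>

lemma singular_reduction_no_new:
  assumes F: "uhit F" and x: "ldeg F x = 1" and m: "ldeg F (- x) \<noteq> 1"
    and y: "ldeg (set_true F x) y = 1"
  shows "ldeg F y = 1"
proof -
  have yx: "\<bar>y\<bar> \<noteq> \<bar>x\<bar>" using ldeg_1_set_true_var[OF F y] .
  obtain C where C: "C \<in> F" "x \<in> C" using ldeg_eq_1E[OF x] by metis
  have "y \<notin> C"
  proof
    assume yC: "y \<in> C"
    have "\<bar>- x\<bar> \<in> var F" using ldeg_1_var[OF x] by simp
    then have "ldeg F (- x) \<ge> 2" using uhit_ldeg_pos[OF F] m
      by (metis One_nat_def Suc_leI le_neq_implies_less numeral_2_eq_2)
    \<comment> \<open>\<open>C\<close> and the clauses containing \<open>-x\<close> all contain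
      \<open>y\<close>. So \<open>y\<close> has degree at least 3, and at least 2 after the loss of
      \<open>C\<close>.\<close>
    have "card (insert C {D \<in> F. - x \<in> D}) \<le> card {D \<in> F. y \<in> D}"
      using uhitD(1)[OF F] by (intro card_mono) (use singular_clause_subset[OF F x C] C yC yx in auto)
    moreover have "C \<notin> {D \<in> F. - x \<in> D}" using C is_clause_lit(2)[OF uhitD(2)[OF F]] by blast
    ultimately have "ldeg F y \<ge> Suc (ldeg F (- x))"
      unfolding ldeg_def using uhitD(1)[OF F] by simp
    then show False
      using ldeg_set_true_singular[OF F x C yx] yC y \<open>ldeg F (- x) \<ge> 2\<close> by simp
  qed
  then show ?thesis using ldeg_set_true_singular[OF F x C yx] y by simp
qed

lemma sing_varsI: "ldeg F x = 1 \<Longrightarrow> \<bar>x\<bar> \<in> sing_vars F"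
  using ldeg_1_var[of F x] by (auto simp: sing_vars_def abs_if)

lemma sing_vars_subsetI:
  assumes F: "uhit F" and S: "\<And>x. ldeg F x = 1 \<Longrightarrow> \<bar>x\<bar> \<in> S"
  shows "sing_vars F \<subseteq> S"
proof
  fix w assume w: "w \<in> sing_vars F"
  then have "w > 0" using uhit_var_pos[OF F] by (auto simp: sing_vars_def)
  then show "w \<in> S" using w S[of w] S[of "- w"] by (auto simp: sing_vars_def)
qed

lemma finite_sing_vars: "uhit F \<Longrightarrow> finite (sing_vars F)"
  using uhit_finite_var by (auto simp: sing_vars_def)

text \<open>Each elimination keeps the deficiency, costs one variable, removes at least one singular
  variable and creates none; a nonsingular clause-set remains, to which \<open>N_sup\<close>
  applies. The second conjunct excludes deficiency 1 as soon as there are variables.\<close>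

lemma no_one_singular_bound:
  assumes "uhit F" "no_one_singular F"
  shows "enat (n_var F) \<le> N_sup (deficiency F) + enat (card (sing_vars F)) \<and>
    (var F \<noteq> {} \<longrightarrow> deficiency F \<ge> 2)"
  using assms
proof (induction "n_var F" arbitrary: F rule: less_induct)
  case less
  note F = less.prems(1)
  show ?case
  proof (cases "\<exists>x. ldeg F x = 1")
    case False
    then have ns: "nonsingular_uhit F" using F by (simp add: nonsingular_uhit_iff)
    then have "enat (n_var F) \<le> N_sup (deficiency F)"
      unfolding N_sup_def by (intro Sup_upper) auto
    then have "enat (n_var F) \<le> N_sup (deficiency F) + enat (card (sing_vars F))"
      by (metis add.right_neutral add_mono zero_le)
    then show ?thesis using nonsingular_deficiency_ge_2[OF ns] by simp
  next
    case True
    then obtain x where x: "ldeg F x = 1" by auto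
    then have m: "ldeg F (- x) \<noteq> 1" using less.prems(2) by (auto simp: no_one_singular_def)
    define H where "H = set_true F x"
    note red = singular_reduction[OF F x, folded H_def]
    have new: "ldeg F y = 1 \<and> \<bar>y\<bar> \<noteq> \<bar>x\<bar>" if "ldeg H y = 1" for y
      using that singular_reduction_no_new[OF F x m] ldeg_1_set_true_var[OF F]
      unfolding H_def by blast
    then have "no_one_singular H" using less.prems(2) by (auto simp: no_one_singular_def)
    then have IH: "enat (n_var H) \<le> N_sup (deficiency H) + enat (card (sing_vars H))"
      "var H \<noteq> {} \<Longrightarrow> deficiency H \<ge> 2"
      using less.hyps[of H] red by auto
    have "sing_vars H \<subseteq> sing_vars F - {\<bar>x\<bar>}"
      by (rule sing_vars_subsetI[OF red(1)]) (simp add: new sing_varsI)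
    moreover have xs: "\<bar>x\<bar> \<in> sing_vars F" using sing_varsI[OF x] .
    ultimately have "card (sing_vars H) < card (sing_vars F)"
      using finite_sing_vars[OF F] by (intro psubset_card_mono) auto
    then have "enat (card (sing_vars H)) + 1 \<le> enat (card (sing_vars F))"
      by (simp add: one_enat_def)
    moreover have "enat (n_var F) = enat (n_var H) + 1" using red(2) by (simp add: one_enat_def)
    ultimately have "enat (n_var F) \<le> N_sup (deficiency F) + enat (card (sing_vars F))"
      using IH(1) red(3) by (metis add.assoc add_left_mono add_right_mono order_trans)
    \<comment> \<open>Elimination never ends in \<open>{{}}\<close>: \<open>F\<close> would have two
      clauses, both containing \<open>-x\<close> because its degree is at least 2, and no clause
      would be left for \<open>x\<close>.\<close>
    moreover have "var H \<noteq> {}"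
    proof
      assume "var H = {}"
      then have "card H = 1" using uhit_no_vars[OF red(1)] by simp
      then have c: "card F = 2" using red(4) by simp
      have "\<bar>- x\<bar> \<in> var F" using ldeg_1_var[OF x] by simp
      then have "ldeg F (- x) \<ge> 2" using uhit_ldeg_pos[OF F] m
        by (metis One_nat_def Suc_leI le_neq_implies_less numeral_2_eq_2)
      then have "{D \<in> F. - x \<in> D} = F"
        using c uhitD(1)[OF F] unfolding ldeg_def by (intro card_seteq) auto
      moreover obtain C where "C \<in> F" "x \<in> C" using ldeg_eq_1E[OF x] by metis
      ultimately show False using is_clause_lit(2)[OF uhitD(2)[OF F]] by blast
    qed
    ultimately show ?thesis using IH(2) red(3) by simp
  qed
qed

section \<open>Full-subsumption resolution\<close>

lemma fs_pair_resolvent: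
  assumes F: "uhit F" and E: "is_clause E" "v \<noteq> 0" "v \<notin> E" "- v \<notin> E"
    and pair: "insert v E \<in> F" "insert (- v) E \<in> F"
    and H: "H = insert E (F - {insert v E, insert (- v) E})"
  shows "E \<notin> F" "uhit H" "card F = card H + 1"
    "\<And>y. \<bar>y\<bar> \<noteq> \<bar>v\<bar> \<Longrightarrow> ldeg F y = ldeg H y + (if y \<in> E then 1 else 0)"
proof -
  show EF: "E \<notin> F"
    using uhit_subsumption_free[OF F _ pair(1)] E by blast
  have ne: "insert v E \<noteq> insert (- v) E" using E by auto
  have fin: "finite F" using uhitD(1)[OF F] .
  have cF: "F = {insert v E, insert (- v) E} \<union> (F - {insert v E, insert (- v) E})"
    using pair by auto
  have "card F = card {insert v E, insert (- v) E} + card (F - {insert v E, insert (- v) E})"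
    by (subst cF, subst card_Un_disjoint) (use fin in auto)
  then show "card F = card H + 1"
    using ne EF fin unfolding H by simp
  \<comment> \<open>If the clashes of \<open>D\<close> with both parents were on the variable
    \<open>v\<close>, then \<open>D\<close> would contain \<open>v\<close> and \<open>-v\<close>. So
    one of them is inherited by \<open>E\<close>.\<close>
  have hitE: "(\<exists>x\<in>E. - x \<in> D) \<and> (\<exists>x\<in>D. - x \<in> E)"
    if D: "D \<in> F" "D \<noteq> insert v E" "D \<noteq> insert (- v) E" for D
  proof -
    obtain y where y: "y \<in> insert v E" "- y \<in> D" using uhitD(4)[OF F pair(1) D(1)] D by blast
    obtain z where z: "z \<in> insert (- v) E" "- z \<in> D" using uhitD(4)[OF F pair(2) D(1)] D by blast
    have "y \<in> E \<or> z \<in> E" using y z is_clause_lit(2)[OF uhitD(2)[OF F D(1)]] by fastforce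
    then show ?thesis using y z by (metis minus_minus)
  qed
  show "uhit H"
    unfolding uhit_def
  proof (intro conjI notI)
    show "is_clause_set H" using E fin uhitD(2)[OF F] by (auto simp: H is_clause_set_def)
    show "hitting H"
      unfolding hitting_def H using hitE uhitD(4)[OF F] by blast
    assume "satisfiable H"
    then obtain P where "is_clause P" "\<And>D. D \<in> H \<Longrightarrow> P \<inter> D \<noteq> {}" by (auto simp: satisfiable_def)
    moreover from this have "P \<inter> D \<noteq> {}" if "D \<in> F" for D using that unfolding H by blast
    ultimately show False using uhitD(3)[OF F] unfolding satisfiable_def by blast
  qed
  fix y assume y: "\<bar>y\<bar> \<noteq> \<bar>v\<bar>"
  then have yv: "y \<noteq> v" "y \<noteq> - v" by auto
  show "ldeg F y = ldeg H y + (if y \<in> E then 1 else 0)"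
  proof (cases "y \<in> E")
    case True
    let ?R = "{D \<in> F - {insert v E, insert (- v) E}. y \<in> D}"
    have "{D \<in> F. y \<in> D} = insert (insert v E) (insert (insert (- v) E) ?R)" using True pair by auto
    then have "ldeg F y = card ?R + 2" using ne fin by (simp add: ldeg_def)
    moreover have "{D \<in> H. y \<in> D} = insert E ?R" using True by (auto simp: H)
    then have "ldeg H y = card ?R + 1" using EF fin by (simp add: ldeg_def)
    ultimately show ?thesis using True by simp
  next
    case False
    then have "{D \<in> F. y \<in> D} = {D \<in> H. y \<in> D}" using yv by (auto simp: H)
    then show ?thesis using False by (simp add: ldeg_def)
  qed
qed

text \<open>An occurrence of \<open>v\<close> outside the pair survives the resolution, so
  \<open>v\<close> is not lost; the variables of \<open>E\<close> survive in
  \<open>E\<close>.\<close>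

lemma strictly_fs_resolvableI:
  assumes F: "uhit F" and E: "is_clause E" "v \<noteq> 0" "v \<notin> E" "- v \<notin> E"
    and pair: "insert v E \<in> F" "insert (- v) E \<in> F" and deg: "ldeg F v \<ge> 2"
  shows "strictly_fs_resolvable F"
proof -
  define H where "H = insert E (F - {insert v E, insert (- v) E})"
  have EF: "E \<notin> F" using fs_pair_resolvent(1)[OF F E pair H_def] .
  have "\<not> {D \<in> F. v \<in> D} \<subseteq> {insert v E}"
    using deg card_mono[of "{insert v E}" "{D \<in> F. v \<in> D}"] by (auto simp: ldeg_def)
  then obtain D where D: "D \<in> F" "v \<in> D" "D \<noteq> insert v E" by auto
  have "D \<noteq> insert (- v) E" using D E by auto
  then have DH: "D \<in> H" using D by (auto simp: H_def)
  have "var H = var F"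
  proof
    show "var H \<subseteq> var F" using pair by (auto simp: H_def var_def var_clause_def)
    have "\<bar>v\<bar> \<in> var H" using DH D(2) by (auto simp: var_iff)
    moreover have "\<bar>y\<bar> \<in> var H" if "y \<in> P" "P \<in> F" "\<bar>y\<bar> \<noteq> \<bar>v\<bar>" for y P
    proof (cases "P \<in> {insert v E, insert (- v) E}")
      case True
      then have "y \<in> E" using that by auto
      then show ?thesis by (auto simp: var_iff H_def)
    next
      case False
      then have "P \<in> H" using that by (simp add: H_def)
      then show ?thesis using that by (auto simp: var_iff)
    qed
    ultimately show "var F \<subseteq> var H" unfolding subset_iff by (metis var_iff)
  qed
  then show ?thesis
    unfolding strictly_fs_resolvable_def fs_resolution_def using E pair EF H_def by blast
qed

text \<open>Eliminating a variable occurring once positively and once negatively can create new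
  singular variables, but here this happens at most twice: first for the resolution variable
  \<open>v\<close>, and then only for a variable whose occurrences are exhausted by the two remaining
  resolvents \<open>E\<close> and \<open>A\<close>.\<close>

lemma strictly_fs_resolvable_reduction:
  assumes ns: "nonsingular_uhit F" and "strictly_fs_resolvable F"
  obtains H j where "uhit H" "no_one_singular H" "deficiency H = deficiency F - 1"
    "n_var F = n_var H + j" "j \<le> 2" "card (sing_vars H) + j \<le> 3"
proof -
  have F: "uhit F" and nF: "\<And>x. ldeg F x \<noteq> 1" using ns by (auto simp: nonsingular_uhit_iff)
  obtain F1 where fs: "fs_resolution F F1" and var1: "var F1 = var F"
    using assms(2) by (auto simp: strictly_fs_resolvable_def)
  obtain E v where E: "is_clause E" "v \<noteq> 0" "v \<notin> E" "- v \<notin> E"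
    and sub: "{insert v E, insert (- v) E} \<subseteq> F"
    and F1: "F1 = insert E (F - {insert v E, insert (- v) E})"
    using fs unfolding fs_resolution_def by (elim exE conjE)
  have pair: "insert v E \<in> F" "insert (- v) E \<in> F" using sub by auto
  note res = fs_pair_resolvent[OF F E pair F1]
  note u1 = res(2)
  have n1: "n_var F1 = n_var F" using var1 by (simp add: n_var_def)
  have d1: "deficiency F1 = deficiency F - 1" using res(3) n1 by (simp add: deficiency_def)
  have E1: "E \<in> F1" by (simp add: F1)
  have clE: "\<And>y. y \<in> E \<Longrightarrow> - y \<notin> E" using is_clause_lit(2)[OF E(1)] by blast
  \<comment> \<open>\<open>F\<close> has no literal of degree 1, so a literal of degree 1 has lost
    an occurrence. For variables other than \<open>v\<close> this happens only to members of
    \<open>E\<close>.\<close>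
  have s1: "y \<in> E" if "ldeg F1 y = 1" "\<bar>y\<bar> \<noteq> \<bar>v\<bar>" for y
    using res(4)[OF that(2)] that(1) nF[of y] by (auto split: if_splits)
  show thesis
  proof (cases "ldeg F1 v = 1 \<and> ldeg F1 (- v) = 1")
    case False
    have no1: "no_one_singular F1"
      unfolding no_one_singular_def
    proof (intro allI notI)
      fix y assume y: "ldeg F1 y = 1 \<and> ldeg F1 (- y) = 1"
      then have "\<bar>y\<bar> \<noteq> \<bar>v\<bar>" using False by (auto simp: abs_eq_iff)
      then show False using y s1[of y] s1[of "- y"] clE by auto
    qed
    \<comment> \<open>Apart from \<open>v\<close>, only one singular literal of \<open>E\<close> is
      possible, so \<open>j = 0\<close> with at most two singular variables.\<close>
    have "sing_vars F1 \<subseteq> insert \<bar>v\<bar> (abs ` {x \<in> E. ldeg F1 x = 1})"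
      by (rule sing_vars_subsetI[OF u1]) (use s1 in auto)
    then have "card (sing_vars F1) \<le> card (insert \<bar>v\<bar> (abs ` {x \<in> E. ldeg F1 x = 1}))"
      using card_singular_literals(2)[OF u1 E1] by (intro card_mono) auto
    also have "\<dots> \<le> 2"
      using card_singular_literals[OF u1 E1] by (simp add: card_insert_if)
    finally show thesis using that[of F1 0] u1 no1 d1 n1 by simp
  next
    case True
    then obtain A where A: "insert v A \<in> F1" "insert (- v) A \<in> F1" "v \<notin> A" "- v \<notin> A" "is_clause A"
      using one_singular_pair[OF u1] by metis
    define F2 where "F2 = set_true F1 v"
    note red2 = singular_reduction[OF u1 conjunct1[OF True], folded F2_def]
    note u2 = red2(1)
    have deg2: "ldeg F1 y = ldeg F2 y + (if y \<in> A then 1 else 0)" if "\<bar>y\<bar> \<noteq> \<bar>v\<bar>" for y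
      using ldeg_set_true_singular[OF u1 conjunct1[OF True] A(1) _ that] that by (auto simp: F2_def)
    have "E - {- v} \<in> F2" using E1 E(3) unfolding F2_def set_true_def by blast
    then have E2: "E \<in> F2" using E(4) by simp
    have "insert (- v) A - {- v} \<in> F2"
      using A E(2) unfolding F2_def set_true_def by (intro imageI) auto
    then have A2: "A \<in> F2" using A(4) by simp
    have clA: "\<And>y. y \<in> A \<Longrightarrow> - y \<notin> A" using is_clause_lit(2)[OF A(5)] by blast
    have nv2: "\<bar>y\<bar> \<noteq> \<bar>v\<bar>" if "ldeg F2 y = 1" for y
      using that ldeg_1_set_true_var[OF u1] unfolding F2_def by blast
    \<comment> \<open>Again a literal of degree 1 has lost an occurrence, now in forming
      \<open>E\<close> or in merging the two clauses over \<open>A\<close>.\<close>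
    have s2: "y \<in> E \<or> y \<in> A" if "ldeg F2 y = 1" for y
      using res(4)[OF nv2[OF that]] deg2[OF nv2[OF that]] that nF[of y] by (auto split: if_splits)
    show thesis
    proof (cases "no_one_singular F2")
      case True
      let ?S = "\<lambda>X. abs ` {x \<in> X. ldeg F2 x = 1}"
      \<comment> \<open>\<open>E\<close> and \<open>A\<close> contribute at most one singular
        literal each, so \<open>j = 1\<close> and the total is at most 3.\<close>
      have "sing_vars F2 \<subseteq> ?S E \<union> ?S A"
        by (rule sing_vars_subsetI[OF u2]) (use s2 in auto)
      then have "card (sing_vars F2) \<le> card (?S E \<union> ?S A)"
        using card_singular_literals(2)[OF u2] E2 A2 by (intro card_mono) auto
      also have "\<dots> \<le> card (?S E) + card (?S A)" by (rule card_Un_le)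
      also have "\<dots> \<le> 2"
        using card_singular_literals(1)[OF u2 E2] card_singular_literals(1)[OF u2 A2] by linarith
      finally show thesis using that[of F2 1] u2 True red2 d1 n1 by simp
    next
      case False
      then obtain y0 where y0: "ldeg F2 y0 = 1" "ldeg F2 (- y0) = 1" by (auto simp: no_one_singular_def)
      \<comment> \<open>Both literals lie in \<open>E\<close> or \<open>A\<close>, and neither
        clause can hold both.\<close>
      have "(y0 \<in> E \<and> - y0 \<in> A) \<or> (- y0 \<in> E \<and> y0 \<in> A)"
        using s2[OF y0(1)] s2[OF y0(2)] clE[of y0] clA[of y0] by blast
      then obtain y where y: "ldeg F2 y = 1" "ldeg F2 (- y) = 1" "y \<in> E" "- y \<in> A"
        using y0 by (metis minus_minus)
      define F3 where "F3 = set_true F2 y"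
      note red3 = singular_reduction[OF u2 y(1), folded F3_def]
      note u3 = red3(1)
      \<comment> \<open>\<open>E\<close> and \<open>A\<close> differ only in the sign of
        \<open>y\<close>, so eliminating \<open>y\<close> merges them into \<open>E - {y}\<close>.
        All literals of degree 1 then lie in this single clause: no complementary pair, at most one
        singular variable, and \<open>j = 2\<close>.\<close>
      have EA: "E - {y} \<subseteq> A" "A - {- y} \<subseteq> E"
        using singular_clause_subset[OF u2 y(1) E2 y(3) A2 y(4)]
          singular_clause_subset[OF u2 y(2) A2 y(4) E2] y(3) by auto
      have "y \<notin> A" using y(4) clA[of y] by auto
      then have "A - {- y} \<in> F3" using A2 unfolding F3_def set_true_def by blast
      moreover have "- y \<notin> E" using clE[OF y(3)] .
      then have "A - {- y} = E - {y}" using EA \<open>y \<notin> A\<close> by blast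
      ultimately have B3: "E - {y} \<in> F3" by simp
      have s3: "z \<in> E - {y}" if z: "ldeg F3 z = 1" for z
      proof (rule ccontr)
        assume no: "z \<notin> E - {y}"
        have zy: "\<bar>z\<bar> \<noteq> \<bar>y\<bar>" using z ldeg_1_set_true_var[OF u2] unfolding F3_def by blast
        then have "z \<notin> E" "z \<notin> A" using no EA by auto
        moreover have "ldeg F2 z = 1"
          using ldeg_set_true_singular[OF u2 y(1) E2 y(3) zy] \<open>z \<notin> E\<close> z by (simp add: F3_def)
        ultimately show False using s2 by blast
      qed
      have no3: "no_one_singular F3"
        unfolding no_one_singular_def using s3 clE by blast
      have "sing_vars F3 \<subseteq> abs ` {x \<in> E - {y}. ldeg F3 x = 1}"
        by (rule sing_vars_subsetI[OF u3]) (use s3 in auto)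
      then have "card (sing_vars F3) \<le> card (abs ` {x \<in> E - {y}. ldeg F3 x = 1})"
        using card_singular_literals(2)[OF u3 B3] by (intro card_mono) auto
      also have "\<dots> \<le> 1" using card_singular_literals(1)[OF u3 B3] .
      finally show thesis using that[of F3 2] u3 no3 red3 red2 d1 n1 by simp
    qed
  qed
qed

text \<open>At deficiency 2 the general bound would only give 3, one more than
  \<open>4 * 2 - 6\<close>. There \<open>H\<close> has deficiency 1, hence no variables, and only
  the at most two eliminated ones count.\<close>

lemma strictly_fs_resolvable_bound:
  assumes ns: "nonsingular_uhit F" and "strictly_fs_resolvable F"
  shows "enat (n_var F) \<le> N_sup (deficiency F - 1) + 3"
    "deficiency F = 2 \<Longrightarrow> n_var F \<le> 2"
proof -
  obtain H j where H: "uhit H" "no_one_singular H" "deficiency H = deficiency F - 1"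
    "n_var F = n_var H + j" "j \<le> 2" "card (sing_vars H) + j \<le> 3"
    using strictly_fs_resolvable_reduction[OF assms] .
  note b = no_one_singular_bound[OF H(1,2)]
  have "enat (n_var F) = enat (n_var H) + enat j" using H(4) by simp
  also have "\<dots> \<le> N_sup (deficiency H) + (enat (card (sing_vars H)) + enat j)"
    using b by (metis add.assoc add_right_mono)
  also have "\<dots> \<le> N_sup (deficiency H) + 3"
    using H(6) by (intro add_left_mono) (simp add: numeral_eq_enat)
  finally show "enat (n_var F) \<le> N_sup (deficiency F - 1) + 3" using H(3) by simp
  assume "deficiency F = 2"
  then have "var H = {}" using b H(3) by auto
  then show "n_var F \<le> 2" using H(4,5) by (simp add: n_var_def)
qed

section \<open>Clause-factorisations\<close>

lemma var_disjointD:
  assumes "var_clause C \<inter> var G = {}" "x \<in> C \<or> - x \<in> C" "D \<in> G"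
  shows "x \<notin> D"
proof
  assume "x \<in> D"
  then have "\<bar>x\<bar> \<in> var G" using assms(3) by (auto simp: var_iff)
  moreover have "\<bar>x\<bar> \<in> abs ` C" using assms(2) by (metis abs_minus_cancel image_eqI)
  ultimately show False using assms(1) by (auto simp: var_clause_def)
qed

lemma clause_products_eq:
  assumes "var_clause C \<inter> var G = {}"
  shows "clause_products C G = (\<union>) C ` G"
proof -
  have "C \<inter> uminus ` D = {}" if "D \<in> G" for D
    using var_disjointD[OF assms _ that] by auto
  then show ?thesis by (auto simp: clause_products_def)
qed

locale uhit_factorisation =
  fixes F F0 G :: clause_set and C :: clause
  assumes F: "uhit F" and factorisation: "clause_factorisation F0 C G" and F_eq: "F = diamond F0 C G"
begin

lemma C_in: "C \<in> F0" and C_clause: "is_clause C" and disj_var: "var_clause C \<inter> var G = {}"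
  and G_unsat: "\<not> satisfiable G" and cls: "is_clause_set F0" "is_clause_set G"
  using factorisation by (auto simp: clause_factorisation_def is_clause_set_def)

lemmas C_notin_G = var_disjointD[OF disj_var]

lemma F_split: "F = (F0 - {C}) \<union> (\<union>) C ` G"
  using F_eq clause_products_eq[OF disj_var] by (simp add: diamond_def)

lemma split_disjoint: "(F0 - {C}) \<inter> (\<union>) C ` G = {}"
  using factorisation clause_products_eq[OF disj_var] by (simp add: clause_factorisation_def)

lemma inj_products: "inj_on ((\<union>) C) G"
proof (rule inj_onI)
  fix D D' assume "D \<in> G" "D' \<in> G" "C \<union> D = C \<union> D'"
  moreover have "C \<inter> D = {}" "C \<inter> D' = {}" using C_notin_G calculation by blast+
  ultimately show "D = D'" by blast
qed

lemma G_nonempty: "G \<noteq> {}"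
  using G_unsat by (auto simp: satisfiable_def is_clause_def)

text \<open>A clash between \<open>C \<union> D\<close> and \<open>C \<union> D'\<close> cannot
  involve \<open>C\<close>, which is a clause and shares no variable with \<open>G\<close>; so it
  lies between \<open>D\<close> and \<open>D'\<close>.\<close>

lemma uhit_G: "uhit G"
  unfolding uhit_def
proof (intro conjI)
  show "hitting G"
    unfolding hitting_def
  proof (intro ballI impI)
    fix D D' assume D: "D \<in> G" "D' \<in> G" "D \<noteq> D'"
    then have "C \<union> D \<noteq> C \<union> D'" using inj_products by (auto dest: inj_onD)
    then obtain x where x: "x \<in> C \<union> D" "- x \<in> C \<union> D'"
      using uhitD(4)[OF F, of "C \<union> D" "C \<union> D'"] D F_split by auto
    have "x \<notin> C" "- x \<notin> C"
      using x C_notin_G[of "- x" D'] C_notin_G[of x D] D is_clause_lit(2)[OF C_clause, of x] by auto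
    then show "\<exists>x\<in>D. - x \<in> D'" using x by blast
  qed
qed (use cls G_unsat in auto)

lemma uhit_F0: "uhit F0"
  unfolding uhit_def
proof (intro conjI notI)
  \<comment> \<open>If \<open>E\<close> did not clash with \<open>C\<close>, it would clash with
    each \<open>C \<union> D\<close> inside \<open>D\<close>, and the complement of \<open>E\<close>
    would satisfy \<open>G\<close>.\<close>
  have clash: "(\<exists>x\<in>C. - x \<in> E) \<and> (\<exists>x\<in>E. - x \<in> C)" if E: "E \<in> F0" "E \<noteq> C" for E
  proof (rule ccontr)
    assume "\<not> ?thesis"
    then have no: "\<not> (\<exists>x\<in>C. - x \<in> E)" by force
    have clE: "is_clause E" using cls E by (auto simp: is_clause_set_def)
    have "uminus ` E \<inter> D \<noteq> {}" if D: "D \<in> G" for D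
    proof -
      have "C \<union> D \<in> F" "E \<in> F" "C \<union> D \<noteq> E" using D E F_split split_disjoint by auto
      then obtain x where "x \<in> C \<union> D" "- x \<in> E" using uhitD(4)[OF F] by blast
      then show ?thesis using no by (auto simp: image_iff intro!: exI[of _ x] bexI[of _ "- x"])
    qed
    moreover have "is_clause (uminus ` E)" using clE by (auto simp: is_clause_def)
    ultimately show False using G_unsat by (auto simp: satisfiable_def)
  qed
  show "hitting F0"
    unfolding hitting_def
  proof (intro ballI impI)
    fix D E assume "D \<in> F0" "E \<in> F0" "D \<noteq> E"
    moreover have "D \<in> F" "E \<in> F" if "D \<noteq> C" "E \<noteq> C" using that calculation F_split by auto
    ultimately show "\<exists>x\<in>D. - x \<in> E" using clash uhitD(4)[OF F] by blast
  qed
  assume "satisfiable F0"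
  then obtain P where P: "is_clause P" "\<And>D. D \<in> F0 \<Longrightarrow> P \<inter> D \<noteq> {}" by (auto simp: satisfiable_def)
  \<comment> \<open>Every clause of \<open>F\<close> contains a clause of \<open>F0\<close>.\<close>
  have "P \<inter> D \<noteq> {}" if "D \<in> F" for D
    using that P(2) C_in unfolding F_split by blast
  then show False using P(1) uhitD(3)[OF F] by (auto simp: satisfiable_def)
qed (use cls in auto)

lemma var_F: "var F = var F0 \<union> var G"
proof -
  have "var ((\<union>) C ` G) = var_clause C \<union> var G"
    using G_nonempty by (auto simp: var_def var_clause_def)
  moreover have "var F0 = var (F0 - {C}) \<union> var_clause C"
    using C_in by (auto simp: var_def)
  moreover have "var F = var (F0 - {C}) \<union> var ((\<union>) C ` G)"
    unfolding F_split by (simp add: var_def)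
  ultimately show ?thesis by (simp add: Un_assoc)
qed

text \<open>\<open>C\<close> is replaced by one clause for each clause of \<open>G\<close>, so
  \<open>c(F) = c(F0) - 1 + c(G)\<close>; a common variable counts for both factors but only once
  for \<open>F\<close>.\<close>

lemma deficiency_F: "deficiency F = deficiency F0 + deficiency G - 1 + int (card (var F0 \<inter> var G))"
  and n_var_F: "n_var F + card (var F0 \<inter> var G) = n_var F0 + n_var G"
proof -
  have fin: "finite F0" "finite G" using cls by (auto simp: is_clause_set_def)
  have "card F = card (F0 - {C}) + card ((\<union>) C ` G)"
    unfolding F_split using fin split_disjoint by (intro card_Un_disjoint) auto
  also have "card ((\<union>) C ` G) = card G" by (rule card_image[OF inj_products])
  finally have "card F + 1 = card F0 + card G"
    using card_Suc_Diff1[OF fin(1) C_in] by simp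
  moreover show "n_var F + card (var F0 \<inter> var G) = n_var F0 + n_var G"
    unfolding n_var_def var_F using card_Un_Int[OF cls[THEN finite_var]] by simp
  ultimately show "deficiency F = deficiency F0 + deficiency G - 1 + int (card (var F0 \<inter> var G))"
    unfolding deficiency_def by linarith
qed

lemma ldeg_F:
  assumes "y \<notin> C"
  shows "ldeg F y = ldeg F0 y + ldeg G y"
proof -
  have fin: "finite F0" "finite G" using cls by (auto simp: is_clause_set_def)
  have "{D \<in> F. y \<in> D} = {D \<in> F0. y \<in> D} \<union> (\<union>) C ` {D \<in> G. y \<in> D}"
    unfolding F_split using assms by auto
  moreover have "{D \<in> F0. y \<in> D} \<inter> (\<union>) C ` {D \<in> G. y \<in> D} = {}"
    using split_disjoint assms by blast
  moreover have "card ((\<union>) C ` {D \<in> G. y \<in> D}) = card {D \<in> G. y \<in> D}"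
    by (rule card_image, rule inj_on_subset[OF inj_products]) auto
  ultimately show ?thesis
    unfolding ldeg_def using fin by (simp add: card_Un_disjoint)
qed

end

section \<open>Factorisations without strict full-subsumption resolution\<close>

locale nonresolvable_factorisation = uhit_factorisation +
  assumes nonsing: "nonsingular_uhit F" and nonres: "\<not> strictly_fs_resolvable F"
begin

lemma ldeg_F_ge_2: "\<bar>x\<bar> \<in> var F0 \<union> var G \<Longrightarrow> ldeg F x \<ge> 2"
  using nonsingular_ldeg_ge_2[OF nonsing] var_F by simp

text \<open>\<open>x\<close> lies outside \<open>C\<close> and has degree at least 2 in
  \<open>F\<close>, which is the sum of its degrees in \<open>F0\<close> and \<open>G\<close>. The
  missing occurrence must come from \<open>F0\<close>.\<close>

lemma singular_G:
  assumes "ldeg G x = 1"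
  shows "\<bar>x\<bar> \<in> var F0 \<inter> var G" "x \<notin> C" "- x \<notin> C"
proof -
  have v: "\<bar>x\<bar> \<in> var G" using ldeg_1_var[OF assms] .
  obtain D where "D \<in> G" "x \<in> D" using ldeg_eq_1E[OF assms] by metis
  then show nC: "x \<notin> C" "- x \<notin> C" using C_notin_G[of x D] by blast+
  then have "ldeg F0 x > 0" using ldeg_F[OF nC(1)] ldeg_F_ge_2[of x] v assms by auto
  then have "\<bar>x\<bar> \<in> var F0" unfolding abs_in_var_iff ldeg_pos_iff[OF uhitD(1)[OF uhit_F0]] by blast
  then show "\<bar>x\<bar> \<in> var F0 \<inter> var G" using v by simp
qed

text \<open>The fs-pair behind such a variable stays an fs-pair of \<open>F\<close> after adding
  \<open>C\<close>, and its resolution is strict because the degree in \<open>F\<close> is at least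
  2.\<close>

lemma no_one_singular_G: "no_one_singular G"
  unfolding no_one_singular_def
proof (intro allI notI)
  fix x assume x: "ldeg G x = 1 \<and> ldeg G (- x) = 1"
  then obtain A where A: "insert x A \<in> G" "insert (- x) A \<in> G" "x \<notin> A" "- x \<notin> A" "x \<noteq> 0"
    using one_singular_pair[OF uhit_G] by metis
  note s = singular_G[OF conjunct1[OF x]]
  have "C \<union> D \<in> F" if "D \<in> G" for D using that by (simp add: F_split)
  from this[OF A(1)] this[OF A(2)]
  have p: "insert x (C \<union> A) \<in> F" "insert (- x) (C \<union> A) \<in> F" by simp_all
  have "is_clause (C \<union> A)" using is_clause_subset[OF uhitD(2)[OF F p(1)]] by blast
  then show False
    using strictly_fs_resolvableI[OF F _ A(5) _ _ p] A s ldeg_F_ge_2 nonres by auto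
qed

lemma singular_F0:
  assumes "ldeg F0 x = 1" "x \<notin> C"
  shows "\<bar>x\<bar> \<in> var F0 \<inter> var G"
proof -
  have v: "\<bar>x\<bar> \<in> var F0" using ldeg_1_var[OF assms(1)] .
  then have "ldeg G x > 0" using ldeg_F[OF assms(2)] ldeg_F_ge_2[of x] assms by auto
  then have "\<bar>x\<bar> \<in> var G" unfolding abs_in_var_iff ldeg_pos_iff[OF uhitD(1)[OF uhit_G]] by blast
  then show ?thesis using v by simp
qed

lemma no_one_singular_F0: "no_one_singular F0"
  unfolding no_one_singular_def
proof (intro allI notI)
  fix x assume x: "ldeg F0 x = 1 \<and> ldeg F0 (- x) = 1"
  \<comment> \<open>If \<open>y\<close> were in \<open>C\<close>, then \<open>-y\<close> would be
    singular and outside \<open>C\<close>, so its variable would occur in \<open>G\<close>, against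
    the disjointness from \<open>C\<close>. Hence the fs-pair avoids \<open>C\<close> and lies in
    \<open>F\<close>.\<close>
  have nC: "y \<notin> C" if "ldeg F0 (- y) = 1" for y
  proof
    assume y: "y \<in> C"
    then have "- y \<notin> C" using is_clause_lit(2)[OF C_clause] by blast
    then have "\<bar>y\<bar> \<in> var G" using singular_F0[OF that] by simp
    then show False using y disj_var by (auto simp: var_clause_def)
  qed
  have nCx: "x \<notin> C" "- x \<notin> C" using nC[of x] nC[of "- x"] x by auto
  obtain A where A: "insert x A \<in> F0" "insert (- x) A \<in> F0" "x \<notin> A" "- x \<notin> A" "is_clause A" "x \<noteq> 0"
    using one_singular_pair[OF uhit_F0] x by metis
  have p: "insert x A \<in> F" "insert (- x) A \<in> F" using A nCx F_split by blast+
  have "ldeg F x \<ge> 2" using ldeg_F_ge_2 ldeg_1_var x by blast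
  then show False using strictly_fs_resolvableI[OF F A(5,6,3,4) p] nonres by simp
qed

lemma card_sing_vars_G: "card (sing_vars G) \<le> card (var F0 \<inter> var G)"
proof (rule card_mono)
  show "finite (var F0 \<inter> var G)" using uhit_finite_var[OF uhit_G] by simp
  show "sing_vars G \<subseteq> var F0 \<inter> var G" by (rule sing_vars_subsetI[OF uhit_G singular_G(1)])
qed

text \<open>The extra 1 is for the single literal of degree 1 that \<open>C\<close> may contain;
  \<open>singular_F0\<close> covers only literals outside \<open>C\<close>.\<close>

lemma card_sing_vars_F0: "card (sing_vars F0) \<le> card (var F0 \<inter> var G) + 1"
proof -
  let ?S = "abs ` {x \<in> C. ldeg F0 x = 1}"
  have "sing_vars F0 \<subseteq> (var F0 \<inter> var G) \<union> ?S"
    by (rule sing_vars_subsetI[OF uhit_F0]) (use singular_F0 in auto)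
  then have "card (sing_vars F0) \<le> card ((var F0 \<inter> var G) \<union> ?S)"
    using uhit_finite_var[OF uhit_G] card_singular_literals(2)[OF uhit_F0 C_in]
    by (intro card_mono) auto
  also have "\<dots> \<le> card (var F0 \<inter> var G) + card ?S" by (rule card_Un_le)
  finally show ?thesis using card_singular_literals(1)[OF uhit_F0 C_in] by linarith
qed

lemma n_var_bound:
  "enat (n_var F) \<le> N_sup (deficiency F0) + N_sup (deficiency G) + enat (card (var F0 \<inter> var G)) + 1"
proof -
  let ?s = "card (var F0 \<inter> var G)"
  have b0: "enat (n_var F0) \<le> N_sup (deficiency F0) + enat (?s + 1)"
    using no_one_singular_bound[OF uhit_F0 no_one_singular_F0] card_sing_vars_F0
    by (meson add_left_mono enat_ord_simps(1) order_trans)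
  have bG: "enat (n_var G) \<le> N_sup (deficiency G) + enat ?s"
    using no_one_singular_bound[OF uhit_G no_one_singular_G] card_sing_vars_G
    by (meson add_left_mono enat_ord_simps(1) order_trans)
  show ?thesis
  \<comment> \<open>With \<open>s\<close> common variables the factors exceed their bounds by
    \<open>s + 1\<close> and \<open>s\<close>, and \<open>n_var_F\<close> subtracts
    \<open>s\<close>, leaving \<open>s + 1\<close>. An infinite value makes the bound
    trivial.\<close>
  proof (cases "N_sup (deficiency F0)"; cases "N_sup (deficiency G)")
    fix a b assume "N_sup (deficiency F0) = enat a" "N_sup (deficiency G) = enat b"
    then show ?thesis using b0 bG n_var_F by (simp add: one_enat_def)
  qed simp_all
qed

text \<open>This places the deficiencies of the factors in the range where the values of
  \<open>N_sup\<close> are assumed known.\<close>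

lemma deficiency_ge_2:
  shows "F0 \<noteq> {{}} \<Longrightarrow> deficiency F0 \<ge> 2" "G \<noteq> {{}} \<Longrightarrow> deficiency G \<ge> 2"
  using no_one_singular_bound[OF uhit_F0 no_one_singular_F0] uhit_var_nonempty[OF uhit_F0]
    no_one_singular_bound[OF uhit_G no_one_singular_G] uhit_var_nonempty[OF uhit_G] by auto

end

section \<open>Combination of the two cases\<close>

theorem theorem1:
  fixes F F0 G :: clause_set and C :: clause and k :: int
  assumes "nonsingular_uhit F"
    and "clause_reducible F"
    and "nontrivial_clause_factorisation F0 C G"
    and "F = diamond F0 C G"
    and "k = deficiency F"
  shows "k \<ge> 2 \<and>
    (strictly_fs_resolvable F \<longrightarrow> enat (n_var F) \<le> N_sup (k - 1) + 3) \<and>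
    (\<not> strictly_fs_resolvable F \<longrightarrow>
      enat (n_var F) \<le> N_sup (deficiency F0) + N_sup (deficiency G)
                        + enat (card (var F0 \<inter> var G)) + 1) \<and>
    ((\<forall>k'::int. 2 \<le> k' \<and> k' < k \<longrightarrow> N_sup k' = enat (nat (4 * k' - 5))) \<longrightarrow>
      (strictly_fs_resolvable F \<longrightarrow> int (n_var F) \<le> 4 * k - 6) \<and>
      (\<not> strictly_fs_resolvable F \<longrightarrow>
        int (n_var F) \<le> 4 * k - 5 - 3 * int (card (var F0 \<inter> var G)) \<and>
        4 * k - 5 - 3 * int (card (var F0 \<inter> var G)) \<le> 4 * k - 5))"
proof -
  have nt: "F0 \<noteq> {{}}" "G \<noteq> {{}}" and "clause_factorisation F0 C G"
    using assms(3) by (auto simp: nontrivial_clause_factorisation_def)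
  moreover have "uhit F" using assms(1) by (simp add: nonsingular_uhit_iff)
  ultimately interpret uhit_factorisation F F0 G C
    using assms(4) by unfold_locales auto
  have "var F \<noteq> {}" using var_F uhit_var_nonempty[OF uhit_G nt(2)] by auto
  then have k2: "k \<ge> 2" using nonsingular_deficiency_ge_2[OF assms(1)] assms(5) by simp
  have r1: "enat (n_var F) \<le> N_sup (k - 1) + 3" if "strictly_fs_resolvable F"
    using strictly_fs_resolvable_bound(1)[OF assms(1) that] assms(5) by simp
  have r3: "int (n_var F) \<le> 4 * k - 6"
    if N: "\<forall>k'::int. 2 \<le> k' \<and> k' < k \<longrightarrow> N_sup k' = enat (nat (4 * k' - 5))"
      and r: "strictly_fs_resolvable F"
  \<comment> \<open>The assumption on \<open>N_sup\<close> starts at 2 and says nothing about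
    \<open>k - 1 = 1\<close>.\<close>
  proof (cases "k = 2")
    case True
    then show ?thesis using strictly_fs_resolvable_bound(2)[OF assms(1) r] assms(5) by simp
  next
    case False
    then have "N_sup (k - 1) = enat (nat (4 * (k - 1) - 5))" using N k2 by simp
    then have "n_var F \<le> nat (4 * (k - 1) - 5) + 3" using r1[OF r] by (simp add: numeral_eq_enat)
    then have "int (n_var F) \<le> int (nat (4 * (k - 1) - 5)) + 3"
      by (metis of_nat_add of_nat_mono of_nat_numeral)
    moreover have "int (nat (4 * (k - 1) - 5)) = 4 * (k - 1) - 5" using False k2 by simp
    ultimately show ?thesis by simp
  qed
  have r2: "enat (n_var F) \<le> N_sup (deficiency F0) + N_sup (deficiency G)
      + enat (card (var F0 \<inter> var G)) + 1"
    and d: "deficiency F0 \<ge> 2" "deficiency G \<ge> 2" if "\<not> strictly_fs_resolvable F"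
  proof -
    interpret nonresolvable_factorisation F F0 G C
      using assms(1) that by unfold_locales
    show "enat (n_var F) \<le> N_sup (deficiency F0) + N_sup (deficiency G)
      + enat (card (var F0 \<inter> var G)) + 1" by (rule n_var_bound)
    show "deficiency F0 \<ge> 2" "deficiency G \<ge> 2" using deficiency_ge_2 nt by auto
  qed
  have r4: "int (n_var F) \<le> 4 * k - 5 - 3 * int (card (var F0 \<inter> var G))"
    if N: "\<forall>k'::int. 2 \<le> k' \<and> k' < k \<longrightarrow> N_sup k' = enat (nat (4 * k' - 5))"
      and r: "\<not> strictly_fs_resolvable F"
  proof -
    note d = d[OF r]
    have k: "k = deficiency F0 + deficiency G - 1 + int (card (var F0 \<inter> var G))"
      using deficiency_F assms(5) by simp
    \<comment> \<open>Each deficiency is at least 2, so by the formula for \<open>k\<close> the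
      other is at most \<open>k - 1\<close>. With \<open>s\<close> common variables the two
      deficiencies sum to \<open>k + 1 - s\<close>, and
      \<open>4 * (k + 1 - s) - 10 + s + 1 = 4 * k - 5 - 3 * s\<close>.\<close>
    then have "N_sup (deficiency F0) = enat (nat (4 * deficiency F0 - 5))"
      "N_sup (deficiency G) = enat (nat (4 * deficiency G - 5))" using N d by auto
    then have "n_var F \<le> nat (4 * deficiency F0 - 5) + nat (4 * deficiency G - 5)
        + card (var F0 \<inter> var G) + 1"
      using r2[OF r] by (simp add: one_enat_def)
    moreover have "int (nat (4 * deficiency F0 - 5)) = 4 * deficiency F0 - 5"
      "int (nat (4 * deficiency G - 5)) = 4 * deficiency G - 5" using d by simp_all
    ultimately show ?thesis using k by linarith
  qed
  show ?thesis using k2 r1 r2 r3 r4 by auto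
qed

end
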